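(* Let $X$ be a stacked simplicial complex of dimension $d$ with vertex set $V$ and facet set $F$, and let $r\ge1$ and $s\ge1$ be integers. Then the maps $\Phi$ and $\Psi$ restrict to mutually inverse bijections between the set of partitions of $V$ into $r+d$ non-empty parts, each part being $(s+1)$-scattered, and the set of partitions of $F$ into $r$ non-empty parts, each part being $s$-scattered.
   Context: A simplicial complex $X$ on a finite vertex set $V$ is a family of subsets (faces) of $V$ closed under taking subsets, every element of $V$ lying in some face; facets are inclusion-maximal faces. $X$ is pure of dimension $d$ if every facet has $d+1$ elements; a codimension one face is a face with $d$ elements. $X$ is stacked if it is pure of some dimension $d$ and its facets can be ordered $F_0,\dots,F_k$ such that for each $p\ge1$, $F_p$ contains exactly one vertex $v_p$ not in $F_0\cup\dots\cup F_{p-1}$, and $F_p\setminus\{v_p\}\subseteq F_j$ for some $j<p$. A walk is a sequence of facets $f_1,\dots,f_p$ ($p\ge1$) with each $f_i\cap f_{i+1}$ of exactly $d$ elements; a path is a walk in which the faces $f_i\cap f_{i+1}$, $1\le i<p$, are pairwise distinct; in a stacked complex there is a unique path between any two facets. For faces $h,k$ with $h\cup k$ not contained in any codimension one face, a path between $h$ and $k$, written $h\,|\,f_1,\dots,f_p\,|\,k$, is a path with $h\subseteq f_1$, $k\subseteq f_p$ and, if $p\ge2$, $h\not\subseteq f_1\cap f_2$, $k\not\subseteq f_p\cap f_{p-1}$; in a stacked complex it exists and is unique. Distances: for facets $f,g$, $\mathrm{dist}(f,g)$ is the minimal $p-1$ over walks $f_1,\dots,f_p$ with $f_1=f$, $f_p=g$;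 for distinct vertices $v,w$, $\mathrm{dist}(v,w)$ is the minimal $p\ge1$ such that there is a walk $f_1,\dots,f_p$ with $v\in f_1$, $w\in f_p$. A set of vertices (resp. facets) is $s$-scattered if any two distinct elements have distance $\ge s$; an independent set of vertices is a $2$-scattered one. The map $\Phi$ (vertex partitions into independent sets $\to$ facet partitions): given such a partition $\mathcal V$ of $V$, for distinct facets $f,f'$ with unique path $f=f_1,\dots,f_p=f'$, let $v$ be the element of $f_1\setminus f_2$ and $w$ the element of $f_p\setminus f_{p-1}$; set $f\sim'_F f'$ iff $v,w$ lie in the same part $P$ of $\mathcal V$ and none of $f_2,\dots,f_{p-1}$ contains a vertex of $P$; $\Phi(\mathcal V)$ is the partition of $F$ into classes of the equivalence relation generated by $\sim'_F$. The map $\Psi$ (facet partitions $\to$ vertex partitions): given a partition $\mathcal F$ of $F$, for distinct vertices $v,w$ not lying in a common facet, with unique path $v\,|\,f_1,\dots,f_p\,|\,w$, set $v\sim'_V w$ iff $f_1,f_p$ lie in the same part $Q$ of $\mathcal F$ and none of $f_2,\dots,f_{p-1}$ lies in $Q$; $\Psi(\mathcal F)$ is the partition of $V$ into classes of the equivalence relation generated by $\sim'_V$. *)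

theory Defs
  imports Main "HOL-Library.Disjoint_Sets" "HOL-Library.Extended_Nat"
begin

(* A simplicial complex is given by its set of faces X; its vertex set is \<Union>X. *)
definition simplicial_complex :: "'a set set \<Rightarrow> bool" where
  "simplicial_complex X \<longleftrightarrow> finite (\<Union>X) \<and> (\<forall>f\<in>X. \<forall>g. g \<subseteq> f \<longrightarrow> g \<in> X)"

definition vertices :: "'a set set \<Rightarrow> 'a set" where
  "vertices X = \<Union>X"

definition facets :: "'a set set \<Rightarrow> 'a set set" where
  "facets X = {f \<in> X. \<forall>g\<in>X. f \<subseteq> g \<longrightarrow> g = f}"

definition pure :: "'a set set \<Rightarrow> nat \<Rightarrow> bool" where
  "pure X d \<longleftrightarrow> (\<forall>f\<in>facets X. card f = d + 1)"

definition stacked :: "'a set set \<Rightarrow> nat \<Rightarrow> bool" where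
  "stacked X d \<longleftrightarrow> simplicial_complex X \<and> pure X d \<and>
     (\<exists>fs. fs \<noteq> [] \<and> distinct fs \<and> set fs = facets X \<and>
        (\<forall>p. 1 \<le> p \<and> p < length fs \<longrightarrow>
           (\<exists>v. fs ! p - \<Union>(set (take p fs)) = {v} \<and>
                (\<exists>j<p. fs ! p - {v} \<subseteq> fs ! j))))"

(* walk: nonempty sequence of facets, consecutive ones meeting in d elements *)
definition walk :: "'a set set \<Rightarrow> nat \<Rightarrow> 'a set list \<Rightarrow> bool" where
  "walk X d fs \<longleftrightarrow> fs \<noteq> [] \<and> set fs \<subseteq> facets X \<and>
     (\<forall>i. Suc i < length fs \<longrightarrow> card (fs ! i \<inter> fs ! Suc i) = d)"

(* path: walk whose consecutive intersections f_i \<inter> f_{i+1} are pairwise distinct *)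
definition is_path :: "'a set set \<Rightarrow> nat \<Rightarrow> 'a set list \<Rightarrow> bool" where
  "is_path X d fs \<longleftrightarrow> walk X d fs \<and>
     distinct (map (\<lambda>i. fs ! i \<inter> fs ! Suc i) [0..<length fs - 1])"

definition facet_dist :: "'a set set \<Rightarrow> nat \<Rightarrow> 'a set \<Rightarrow> 'a set \<Rightarrow> enat" where
  "facet_dist X d f g =
     (INF fs \<in> {fs. walk X d fs \<and> hd fs = f \<and> last fs = g}. enat (length fs - 1))"

definition vertex_dist :: "'a set set \<Rightarrow> nat \<Rightarrow> 'a \<Rightarrow> 'a \<Rightarrow> enat" where
  "vertex_dist X d v w =
     (INF fs \<in> {fs. walk X d fs \<and> v \<in> hd fs \<and> w \<in> last fs}. enat (length fs))"

definition vertex_scattered :: "'a set set \<Rightarrow> nat \<Rightarrow> nat \<Rightarrow> 'a set \<Rightarrow> bool" where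
  "vertex_scattered X d s S \<longleftrightarrow>
     (\<forall>v\<in>S. \<forall>w\<in>S. v \<noteq> w \<longrightarrow> enat s \<le> vertex_dist X d v w)"

definition facet_scattered :: "'a set set \<Rightarrow> nat \<Rightarrow> nat \<Rightarrow> 'a set set \<Rightarrow> bool" where
  "facet_scattered X d s S \<longleftrightarrow>
     (\<forall>f\<in>S. \<forall>g\<in>S. f \<noteq> g \<longrightarrow> enat s \<le> facet_dist X d f g)"

(* the relation \<sim>'_F used to define \<Phi> *)
definition PhiRel :: "'a set set \<Rightarrow> nat \<Rightarrow> 'a set set \<Rightarrow> ('a set \<times> 'a set) set" where
  "PhiRel X d VV = {(f, f'). f \<in> facets X \<and> f' \<in> facets X \<and> f \<noteq> f' \<and>
     (\<exists>fs v w. is_path X d fs \<and> hd fs = f \<and> last fs = f' \<and> 2 \<le> length fs \<and>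
        fs ! 0 - fs ! 1 = {v} \<and> last fs - fs ! (length fs - 2) = {w} \<and>
        (\<exists>P\<in>VV. v \<in> P \<and> w \<in> P \<and> (\<forall>i. 1 \<le> i \<and> i < length fs - 1 \<longrightarrow> fs ! i \<inter> P = {})))}"

definition Phi :: "'a set set \<Rightarrow> nat \<Rightarrow> 'a set set \<Rightarrow> 'a set set set" where
  "Phi X d VV = facets X // ((PhiRel X d VV \<union> (PhiRel X d VV)\<inverse>)\<^sup>*)"

(* the relation \<sim>'_V used to define \<Psi> *)
definition PsiRel :: "'a set set \<Rightarrow> nat \<Rightarrow> 'a set set set \<Rightarrow> ('a \<times> 'a) set" where
  "PsiRel X d FF = {(v, w). v \<in> vertices X \<and> w \<in> vertices X \<and> v \<noteq> w \<and>
     \<not> (\<exists>f\<in>facets X. v \<in> f \<and> w \<in> f) \<and>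
     (\<exists>fs. is_path X d fs \<and> v \<in> hd fs \<and> w \<in> last fs \<and>
        (2 \<le> length fs \<longrightarrow> v \<notin> fs ! 0 \<inter> fs ! 1 \<and> w \<notin> last fs \<inter> fs ! (length fs - 2)) \<and>
        (\<exists>Q\<in>FF. hd fs \<in> Q \<and> last fs \<in> Q \<and> (\<forall>i. 1 \<le> i \<and> i < length fs - 1 \<longrightarrow> fs ! i \<notin> Q)))}"

definition Psi :: "'a set set \<Rightarrow> nat \<Rightarrow> 'a set set set \<Rightarrow> 'a set set" where
  "Psi X d FF = vertices X // ((PsiRel X d FF \<union> (PsiRel X d FF)\<inverse>)\<^sup>*)"

end

theory Submission
  imports Defs
begin

text \<open>
  View a partition of the vertices into \<open>r + d\<close> independent sets as a colouring \<open>c\<close> that is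
  injective on facets, and a partition of the facets into \<open>r\<close> parts as a labelling \<open>\<phi>\<close>.
  A codimension one face misses exactly \<open>r\<close> colours. The colouring and the labelling correspond when
  each codimension one face \<open>g\<close> carries a bijection \<open>\<beta> g\<close> from the colours it misses to the labels
  such that \<open>\<beta> g (c v) = \<phi> f\<close> whenever \<open>f = insert v g\<close> is a facet, and such that all \<open>\<beta> g\<close> with
  \<open>g \<subseteq> f\<close> agree on the colours missing in \<open>f\<close>.

  Along the stacking order, each new facet \<open>f\<close> brings one new vertex \<open>v\<close>, and \<open>\<beta>\<close> on \<open>f - {v}\<close>
  makes the choice of \<open>c v\<close> equivalent to the choice of \<open>\<phi> f\<close>. So every colouring extends to such a
  triple, and so does every labelling. Following a fixed colour along a walk shows that
  the relations defining \<open>\<Phi>\<close> and \<open>\<Psi>\<close> express the same condition on a path, once in terms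
  of \<open>c\<close> and once in terms of \<open>\<phi>\<close>; hence \<open>\<Phi>\<close> takes the fibres of \<open>c\<close> to those of \<open>\<phi>\<close>, and \<open>\<Psi>\<close>
  takes them back. Applied to a shortest walk joining two elements of one part, the same equivalence
  compares the scatteredness of both partitions.
\<close>

section \<open>Intersections of facets, fibres and partitions\<close>

lemma card_Int_eqI:
  assumes "finite f" "finite h" "card f = Suc d" "card h = Suc d" "f \<noteq> h"
    and "g \<subseteq> f" "g \<subseteq> h" "card g = d"
  shows "f \<inter> h = g"
proof -
  have "card (f \<inter> h) < Suc d"
    using assms by (metis Int_lower1 Int_lower2 card_mono card_subset_eq not_less_eq_eq order_antisym not_less)
  moreover have "g \<subseteq> f \<inter> h" using assms by auto
  ultimately show ?thesis
    using assms by (metis card_seteq finite_Int less_Suc_eq_le)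
qed

lemma Diff_singleton_of_card_Int:
  assumes "finite f" "card f = Suc d" "card (f \<inter> h) = d"
  obtains v where "f - h = {v}"
proof -
  have "card (f - h) = 1"
    using assms by (simp add: card_Diff_subset_Int)
  then show thesis using that by (auto simp: card_1_singleton_iff)
qed

text \<open>Partitions are handled as fibres of functions, so that colours and labels may come from
  any type.\<close>

definition fibres :: "('b \<Rightarrow> 'c) \<Rightarrow> 'b set \<Rightarrow> 'b set set" where
  "fibres h S = (\<lambda>x. {y \<in> S. h y = h x}) ` S"

lemma partition_on_fibres: "partition_on S (fibres h S)"
  unfolding partition_on_def disjoint_def fibres_def by auto

lemma card_fibres: "card (fibres h S) = card (h ` S)"
proof -
  have "fibres h S = (\<lambda>k. {y \<in> S. h y = k}) ` h ` S"
    unfolding fibres_def by auto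
  moreover have "inj_on (\<lambda>k. {y \<in> S. h y = k}) (h ` S)"
    by (rule inj_onI) blast
  ultimately show ?thesis by (simp add: card_image)
qed

text \<open>The function sends each element to its part, so the parts themselves become the colours
  or labels.\<close>

lemma partition_on_eq_fibres:
  assumes "partition_on S PP"
  obtains h where "\<And>x. x \<in> S \<Longrightarrow> x \<in> h x" "h ` S = PP" "fibres h S = PP"
proof -
  define h where "h x = (THE P. P \<in> PP \<and> x \<in> P)" for x
  have h: "h x = P" if "P \<in> PP" "x \<in> P" for x P
    unfolding h_def using that assms
    by (intro the_equality) (auto simp: partition_on_def disjoint_def)
  have mem: "h x \<in> PP \<and> x \<in> h x" if "x \<in> S" for x
    using that assms h by (metis UnionE partition_on_def)
  have fib: "{y \<in> S. h y = h x} = h x" if "x \<in> S" for x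
    using mem that h assms by (auto simp: partition_on_def)
  have im: "h ` S = PP"
  proof
    show "PP \<subseteq> h ` S"
    proof
      fix P assume P: "P \<in> PP"
      then obtain x where "x \<in> P" using assms by (metis all_not_in_conv partition_on_def)
      then show "P \<in> h ` S" using h P assms by (metis UnionI image_eqI partition_on_def)
    qed
  qed (use mem in auto)
  show thesis
  proof (rule that)
    show "x \<in> S \<Longrightarrow> x \<in> h x" for x using mem by blast
    show "h ` S = PP" by (rule im)
    show "fibres h S = PP" using im fib by (auto simp: fibres_def)
  qed
qed

text \<open>\<open>sound\<close> keeps each class inside a fibre of \<open>h\<close>, and
  \<open>complete\<close> makes each fibre connected. Since the closure is reflexive on the whole
  type, \<open>T \<subseteq> S \<times> S\<close> is what keeps the classes of elements of
  \<open>S\<close> inside \<open>S\<close>. Both \<open>Phi\<close> and \<open>Psi\<close> are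
  quotients of this shape.\<close>

lemma quotient_eq_fibres:
  assumes "T \<subseteq> S \<times> S"
    and sound: "\<And>x y. (x, y) \<in> T \<Longrightarrow> h x = h y"
    and complete: "\<And>x y. x \<in> S \<Longrightarrow> y \<in> S \<Longrightarrow> h x = h y \<Longrightarrow> (x, y) \<in> (T \<union> T\<inverse>)\<^sup>*"
  shows "S // ((T \<union> T\<inverse>)\<^sup>*) = fibres h S"
proof -
  have cl: "y \<in> S \<and> h y = h x" if "(x, y) \<in> (T \<union> T\<inverse>)\<^sup>*" "x \<in> S" for x y
    using that
  proof (induction rule: rtrancl_induct)
    case (step y z) then show ?case using assms(1) sound[of y z] sound[of z y] by auto
  qed auto
  have "(T \<union> T\<inverse>)\<^sup>* `` {x} = {y \<in> S. h y = h x}" if "x \<in> S" for x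
    using cl complete that by (metis (mono_tags, lifting) Collect_cong Image_singleton)
  then show ?thesis by (auto simp: quotient_def fibres_def)
qed

section \<open>Couplings and their extension by one facet\<close>

text \<open>The bijections \<open>\<beta>\<close> are encoded facetwise: \<open>\<alpha> f\<close> is a total map on colours that restricts to
  \<open>\<beta> g\<close> for every codimension one face \<open>g\<close> of \<open>f\<close>, which forces it to be constantly \<open>\<phi> f\<close> on the
  colours of \<open>f\<close>.\<close>

definition coupled ::
    "nat \<Rightarrow> 'a set set \<Rightarrow> ('a \<Rightarrow> 'n) \<Rightarrow> ('a set \<Rightarrow> 'r) \<Rightarrow> ('a set \<Rightarrow> 'n \<Rightarrow> 'r) \<Rightarrow> 'n set \<Rightarrow> 'r set \<Rightarrow> bool" where
  "coupled d S c \<phi> \<alpha> N R \<longleftrightarrow>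
     (\<forall>f\<in>S. inj_on c f \<and> c ` f \<subseteq> N \<and> \<phi> f \<in> R \<and> (\<forall>P\<in>c ` f. \<alpha> f P = \<phi> f) \<and>
        bij_betw (\<alpha> f) (N - c ` f) (R - {\<phi> f})) \<and>
     (\<forall>f\<in>S. \<forall>g\<in>S. card (f \<inter> g) = d \<longrightarrow> (\<forall>P\<in>N - c ` (f \<inter> g). \<alpha> f P = \<alpha> g P))"

text \<open>The colours missing in \<open>f\<close> and the labels other than
  \<open>\<phi> f\<close> both number \<open>card R - 1\<close>, so some bijection between them
  exists.\<close>

lemma coupled_singleton:
  assumes "inj_on c f" "c ` f \<subseteq> N" "\<phi> f \<in> R" "finite N" "finite R"
    and "card f = d + 1" "card N = card R + d"
  obtains \<alpha> where "coupled d {f} c \<phi> \<alpha> N R"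
proof -
  have "card (N - c ` f) = card (R - {\<phi> f})"
    using assms by (simp add: card_Diff_subset card_image finite_subset)
  then obtain b where b: "bij_betw b (N - c ` f) (R - {\<phi> f})"
    using assms by (meson finite_Diff finite_same_card_bij)
  let ?a = "\<lambda>P. if P \<in> c ` f then \<phi> f else b P"
  have "bij_betw ?a (N - c ` f) (R - {\<phi> f})"
    by (subst bij_betw_cong[where g = b]) (use b in auto)
  then have "coupled d {f} c \<phi> (\<lambda>_. ?a) N R"
    using assms by (auto simp: coupled_def)
  then show thesis using that by blast
qed

text \<open>This recovers the bijection of the codimension one face \<open>h - {u}\<close> from
  \<open>\<alpha> h\<close>: compared with \<open>h\<close>, the domain gains the colour
  \<open>c u\<close>, the range gains the label \<open>\<phi> h\<close>, and
  \<open>\<alpha> h\<close> sends the one to the other.\<close>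

lemma coupled_bij_betw:
  assumes "coupled d S c \<phi> \<alpha> N R" "h \<in> S" "u \<in> h"
  shows "bij_betw (\<alpha> h) (N - c ` (h - {u})) R"
proof -
  have h: "inj_on c h" "c ` h \<subseteq> N" "\<phi> h \<in> R" "\<alpha> h (c u) = \<phi> h"
    "bij_betw (\<alpha> h) (N - c ` h) (R - {\<phi> h})"
    using assms by (auto simp: coupled_def)
  have "N - c ` (h - {u}) = insert (c u) (N - c ` h)"
    using h(1,2) assms(3) by (auto simp: inj_on_def)
  moreover have "bij_betw (\<alpha> h) (insert (c u) (N - c ` h)) (insert (\<alpha> h (c u)) (R - {\<phi> h}))"
    using h assms(3) notIn_Un_bij_betw[of "c u" "N - c ` h" "\<alpha> h" "R - {\<phi> h}"] by auto
  ultimately show ?thesis using h(3,4) by (simp add: insert_absorb)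
qed

text \<open>The colour \<open>P\<close> of the new vertex is free among those missing on the gluing
  face, and the label \<open>\<alpha> h P\<close> is then forced. As \<open>\<alpha> h\<close> is a
  bijection there, the lemma serves a prescribed colour, with \<open>P = c v\<close>, as well as a
  prescribed label, with \<open>P\<close> chosen so that
  \<open>\<alpha> h P = \<phi> f\<close>.\<close>

lemma coupled_insert:
  assumes cp: "coupled d S c \<phi> \<alpha> N R"
    and card: "\<And>g. g \<in> insert f S \<Longrightarrow> card g = Suc d"
    and v: "v \<in> f" "v \<notin> \<Union>S" and h: "h \<in> S" "f - {v} \<subseteq> h"
    and P: "P \<in> N - c ` (f - {v})"
  shows "coupled d (insert f S) (c(v := P)) (\<phi>(f := \<alpha> h P))
           (\<alpha>(f := \<lambda>P'. if P' \<in> c ` (f - {v}) then \<alpha> h P else \<alpha> h P')) N R"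
    (is "coupled d _ ?c ?\<phi> ?\<alpha> N R")
proof -
  have fin: "finite g" if "g \<in> insert f S" for g
    using card[OF that] by (metis card.infinite nat.distinct(1))
  define c' where "c' = ?c"
  have c'[simp]: "c' v = P" "x \<noteq> v \<Longrightarrow> c' x = c x" for x by (auto simp: c'_def)
  define e where "e = f - {v}"
  have card_e: "card e = d" using card[of f] v fin[of f] by (simp add: e_def)
  have f_eq: "f = insert v e" and ve: "v \<notin> e" using v by (auto simp: e_def)
  have eh: "e \<subseteq> h" using h by (simp add: e_def)
  have "card (h - e) = 1"
    using card_Diff_subset[of e h] card_e eh card[of h] h fin[of f] by (simp add: e_def)
  \<comment> \<open>\<open>u\<close> is the vertex of \<open>h\<close> opposite the gluing face
    \<open>e\<close>.\<close>
  then obtain u where u: "h - e = {u}" by (auto simp: card_1_singleton_iff)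
  have e_hu: "e = h - {u}" and uh: "u \<in> h" using u eh by auto
  have bij: "bij_betw (\<alpha> h) (N - c ` e) R"
    using coupled_bij_betw[OF cp h(1) uh] e_hu by simp
  have Pe: "P \<in> N" "P \<notin> c ` e" using P by (auto simp: e_def)
  have injh: "inj_on c h" "c ` h \<subseteq> N" using cp h by (auto simp: coupled_def)
  have c_eq: "c' ` g = c ` g" if "v \<notin> g" for g using that c'(2) by (intro image_cong) metis+
  have vS: "v \<notin> g" if "g \<in> S" for g using v that by auto
  have fS: "f \<notin> S" using v by auto
  have cf: "c' ` f = insert P (c ` e)" using f_eq c_eq[OF ve] by simp
  have one_old: "inj_on c' g \<and> c' ` g \<subseteq> N \<and> ?\<phi> g \<in> R \<and> (\<forall>P\<in>c' ` g. ?\<alpha> g P = ?\<phi> g) \<and>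
        bij_betw (?\<alpha> g) (N - c' ` g) (R - {?\<phi> g})" if "g \<in> S" for g
  proof -
    have "g \<noteq> f" using fS that by auto
    moreover have "inj_on c' g \<longleftrightarrow> inj_on c g"
      by (rule inj_on_cong) (use vS[OF that] c'(2) in metis)
    ultimately show ?thesis
      using cp that c_eq[OF vS[OF that]] by (auto simp: coupled_def)
  qed
  have inje: "inj_on c e" using injh(1) eh inj_on_subset by blast
  have one_new: "inj_on c' f \<and> c' ` f \<subseteq> N \<and> ?\<phi> f \<in> R \<and> (\<forall>P\<in>c' ` f. ?\<alpha> f P = ?\<phi> f) \<and>
        bij_betw (?\<alpha> f) (N - c' ` f) (R - {?\<phi> f})"
  proof (intro conjI)
    show "inj_on c' f"
    proof -
      have "inj_on c' e \<longleftrightarrow> inj_on c e" by (rule inj_on_cong) (use ve c'(2) in metis)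
      then show ?thesis using inje Pe ve c_eq[OF ve] unfolding f_eq by simp
    qed
    show "c' ` f \<subseteq> N" using cf Pe(1) injh(2) image_mono[OF eh, of c] by auto
    show "?\<phi> f \<in> R" using bij Pe by (auto dest: bij_betwE)
    show "\<forall>P\<in>c' ` f. ?\<alpha> f P = ?\<phi> f" unfolding cf by (auto simp: e_def)
    have "bij_betw (\<alpha> h) (N - c ` e - {P}) (R - {\<alpha> h P})"
      using bij Pe by (meson Diff_iff bij_betw_DiffI bij_betw_singletonI  empty_subsetI insert_subset bij_betwE)
    moreover have "N - c' ` f = N - c ` e - {P}" unfolding cf by auto
    moreover have "bij_betw (?\<alpha> f) (N - c ` e - {P}) (R - {\<alpha> h P}) \<longleftrightarrow>
        bij_betw (\<alpha> h) (N - c ` e - {P}) (R - {\<alpha> h P})"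
      by (rule bij_betw_cong) (auto simp: e_def)
    ultimately show "bij_betw (?\<alpha> f) (N - c' ` f) (R - {?\<phi> f})" by simp
  qed
  have two_old: "?\<alpha> g P' = ?\<alpha> g' P'"
    if "g \<in> S" "g' \<in> S" "card (g \<inter> g') = d" "P' \<in> N - c' ` (g \<inter> g')" for g g' P'
  proof -
    have "P' \<in> N - c ` (g \<inter> g')" using that c_eq[of "g \<inter> g'"] vS by auto
    then show ?thesis using cp that fS by (auto simp: coupled_def)
  qed
  have two_new: "?\<alpha> f P' = ?\<alpha> g P'"
    if "g \<in> S" "card (f \<inter> g) = d" "P' \<in> N - c' ` (f \<inter> g)" for g P'
  proof -
    \<comment> \<open>Since \<open>v\<close> is new, \<open>e\<close> is the only face along which
      an old facet can be adjacent to \<open>f\<close>.\<close>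
    have "f \<inter> g \<subseteq> e" using vS[OF that(1)] f_eq by auto
    then have fg: "f \<inter> g = e"
      using that(2) card_e fin[of f] f_eq by (metis card_subset_eq finite_insert insertI1)
    have P': "P' \<in> N - c ` e" using that(3) fg c_eq[OF ve] by simp
    have "\<alpha> h P' = \<alpha> g P'"
    proof (cases "g = h")
      case False
      \<comment> \<open>Two distinct old facets through \<open>e\<close> are adjacent along it, so
        the old coupling already makes \<open>\<alpha> h\<close> and \<open>\<alpha> g\<close> agree
        on the colours missing in \<open>e\<close>.\<close>
      have "h \<inter> g = e"
        using card_Int_eqI[of h g d e] fin card that(1) h(1) False eh fg card_e by auto
      then show ?thesis using cp h(1) that(1) card_e P' by (auto simp: coupled_def)
    qed simp
    then show ?thesis using P' that(1) fS by (auto simp: e_def)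
  qed
  have two_self: "card (f \<inter> f) \<noteq> d" using card[of f] by simp
  have one: "inj_on c' g \<and> c' ` g \<subseteq> N \<and> ?\<phi> g \<in> R \<and> (\<forall>P\<in>c' ` g. ?\<alpha> g P = ?\<phi> g) \<and>
        bij_betw (?\<alpha> g) (N - c' ` g) (R - {?\<phi> g})" if "g \<in> insert f S" for g
  proof (cases "g = f")
    case True
    show ?thesis unfolding True by (rule one_new)
  next
    case False
    then have "g \<in> S" using that by simp
    then show ?thesis by (rule one_old)
  qed
  have two: "?\<alpha> g P' = ?\<alpha> g' P'"
    if "g \<in> insert f S" "g' \<in> insert f S" "card (g \<inter> g') = d" "P' \<in> N - c' ` (g \<inter> g')" for g g' P'
  proof -
    note g = that
    consider "g \<in> S" "g' \<in> S" | "g = f" "g' \<in> S" | "g \<in> S" "g' = f"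
      using g(1-3) two_self by blast
    then show ?thesis
    proof cases
      case 1 then show ?thesis using two_old g(3,4) by blast
    next
      case 2 then show ?thesis using two_new[of g' P'] g(3,4) by simp
    next
      case 3 then show ?thesis using two_new[of g P'] g(3,4) by (simp add: Int_commute)
    qed
  qed
  show ?thesis
    unfolding coupled_def c'_def[symmetric]
  proof (rule conjI; rule ballI)
    fix g assume g: "g \<in> insert f S"
    show "\<forall>g'\<in>insert f S. card (g \<inter> g') = d \<longrightarrow> (\<forall>P\<in>N - c' ` (g \<inter> g'). ?\<alpha> g P = ?\<alpha> g' P)"
      using two[OF g] by blast
  qed (fact one)
qed

subsection \<open>Walks and paths in stacked complexes\<close>

lemma walk_iff_successively:
  "walk X d fs \<longleftrightarrow> fs \<noteq> [] \<and> set fs \<subseteq> facets X \<and> successively (\<lambda>f g. card (f \<inter> g) = d) fs"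
  by (auto simp: walk_def successively_conv_nth)

lemma walk_singleton: "f \<in> facets X \<Longrightarrow> walk X d [f]"
  by (simp add: walk_iff_successively)

lemma walk_append:
  assumes "walk X d xs" "walk X d ys" "card (last xs \<inter> hd ys) = d"
  shows "walk X d (xs @ ys)"
  using assms by (auto simp: walk_iff_successively successively_append_iff)

lemma walk_take: "walk X d fs \<Longrightarrow> 0 < n \<Longrightarrow> walk X d (take n fs)"
  by (auto simp: walk_def dest: in_set_takeD)

lemma walk_drop: "walk X d fs \<Longrightarrow> n < length fs \<Longrightarrow> walk X d (drop n fs)"
  by (auto simp: walk_def dest: in_set_dropD)

lemma walk_rev: "walk X d fs \<Longrightarrow> walk X d (rev fs)"
  by (simp add: walk_iff_successively Int_commute)

lemma last_take_Suc: "i < length fs \<Longrightarrow> last (take (Suc i) fs) = fs ! i"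
  by (simp add: take_Suc_conv_app_nth)

text \<open>Facet distance counts the steps of a walk and vertex distance counts its facets. This is
  the source of the shift between \<open>s\<close> and \<open>s + 1\<close>.\<close>

lemma facet_scattered_iff:
  "facet_scattered X d s Q \<longleftrightarrow>
     (\<forall>fs. walk X d fs \<longrightarrow> hd fs \<in> Q \<longrightarrow> last fs \<in> Q \<longrightarrow> hd fs \<noteq> last fs \<longrightarrow> s \<le> length fs - 1)"
  unfolding facet_scattered_def facet_dist_def le_INF_iff by auto

lemma vertex_scattered_iff:
  "vertex_scattered X d s P \<longleftrightarrow>
     (\<forall>fs v w. walk X d fs \<longrightarrow> v \<in> P \<longrightarrow> w \<in> P \<longrightarrow> v \<noteq> w \<longrightarrow> v \<in> hd fs \<longrightarrow> w \<in> last fs \<longrightarrow> s \<le> length fs)"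
  unfolding vertex_scattered_def vertex_dist_def le_INF_iff by auto

locale stacked_complex =
  fixes X :: "'a set set" and d :: nat
  assumes stacked: "stacked X d"
begin

lemma card_facet: "f \<in> facets X \<Longrightarrow> card f = Suc d"
  using stacked by (simp add: stacked_def pure_def)

lemma finite_facet: "f \<in> facets X \<Longrightarrow> finite f"
  using card_facet by (metis card.infinite nat.distinct(1))

lemma vertices_eq_Union_facets: "vertices X = \<Union>(facets X)"
proof
  show "vertices X \<subseteq> \<Union>(facets X)"
  proof
    fix v assume "v \<in> vertices X"
    then obtain x where x: "x \<in> X" "v \<in> x" by (auto simp: vertices_def)
    have "finite (\<Union>X)" using stacked by (simp add: stacked_def simplicial_complex_def)
    then have "finite X" by (rule finite_UnionD)
    then obtain m where "m \<in> X" "x \<subseteq> m" "\<forall>y\<in>X. m \<subseteq> y \<longrightarrow> m = y"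
      using finite_has_maximal2[OF _ x(1)] by metis
    then show "v \<in> \<Union>(facets X)" using x by (auto simp: facets_def)
  qed
qed (auto simp: vertices_def facets_def)

lemma stacking_order:
  obtains fs where "fs \<noteq> []" "distinct fs" "set fs = facets X"
    and "\<And>p. 0 < p \<Longrightarrow> p < length fs \<Longrightarrow>
      \<exists>v j. fs ! p - \<Union>(set (take p fs)) = {v} \<and> j < p \<and> fs ! p - {v} \<subseteq> fs ! j"
proof -
  obtain fs where "fs \<noteq> []" "distinct fs" "set fs = facets X"
    "\<forall>p. 1 \<le> p \<and> p < length fs \<longrightarrow>
           (\<exists>v. fs ! p - \<Union>(set (take p fs)) = {v} \<and> (\<exists>j<p. fs ! p - {v} \<subseteq> fs ! j))"
    using stacked unfolding stacked_def by auto
  then show thesis by (intro that[of fs]) (auto simp: Suc_le_eq)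
qed

text \<open>The sets \<open>S\<close> are the initial segments of a stacking order, and
  \<open>h\<close> is an earlier facet to which \<open>f\<close> is attached. Connectedness and both
  constructions of couplings follow this scheme.\<close>

lemma stacking_induct [consumes 1, case_names base step]:
  assumes "f \<in> facets X"
    and base: "\<And>f. f \<in> facets X \<Longrightarrow> T {f}"
    and step: "\<And>S f h v. S \<subseteq> facets X \<Longrightarrow> f \<in> facets X \<Longrightarrow> h \<in> S \<Longrightarrow> v \<in> f \<Longrightarrow> v \<notin> \<Union>S \<Longrightarrow>
      f - {v} \<subseteq> h \<Longrightarrow> T S \<Longrightarrow> T (insert f S)"
  shows "T (facets X)"
proof -
  obtain fs where fs: "fs \<noteq> []" "distinct fs" "set fs = facets X"
    "\<And>p. 0 < p \<Longrightarrow> p < length fs \<Longrightarrow>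
      \<exists>v j. fs ! p - \<Union>(set (take p fs)) = {v} \<and> j < p \<and> fs ! p - {v} \<subseteq> fs ! j"
    using stacking_order by blast
  have "T (set (take (Suc p) fs))" if "p < length fs" for p
    using that
  proof (induction p)
    case 0
    then have "fs ! 0 \<in> facets X" using fs(3) nth_mem by blast
    then show ?case using fs(1) base[of "fs ! 0"] by (simp add: take_Suc hd_conv_nth)
  next
    case (Suc p)
    obtain v j where v: "fs ! Suc p - \<Union>(set (take (Suc p) fs)) = {v}" "j < Suc p"
      "fs ! Suc p - {v} \<subseteq> fs ! j"
      using fs(4)[of "Suc p"] Suc.prems by auto
    have "T (insert (fs ! Suc p) (set (take (Suc p) fs)))"
    proof (rule step[where h = "fs ! j" and v = v])
      show "set (take (Suc p) fs) \<subseteq> facets X" using fs(3) set_take_subset by fastforce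
      show "fs ! Suc p \<in> facets X" using fs(3) Suc.prems nth_mem by blast
      show "fs ! j \<in> set (take (Suc p) fs)" using v(2) Suc.prems by (auto simp: in_set_conv_nth)
    qed (use v Suc in auto)
    then show ?case using Suc.prems by (simp add: take_Suc_conv_app_nth[of "Suc p"])
  qed
  from this[of "length fs - 1"] show ?thesis using fs(1,3) by simp
qed

lemma card_Int_stacking:
  assumes "f \<in> facets X" "v \<in> f" "v \<notin> h" "f - {v} \<subseteq> h"
  shows "card (f \<inter> h) = d"
proof -
  have "f \<inter> h = f - {v}" using assms by auto
  then show ?thesis using assms card_facet finite_facet by simp
qed

text \<open>Each new facet is adjacent to an earlier one, so walks inside an initial segment extend
  to it by one step.\<close>

lemma exists_walk:
  assumes "f \<in> facets X" "g \<in> facets X"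
  obtains fs where "walk X d fs" "hd fs = f" "last fs = g"
proof -
  have "\<forall>f\<in>facets X. \<forall>g\<in>facets X. \<exists>fs. walk X d fs \<and> hd fs = f \<and> last fs = g"
    using assms(1)
  proof (induction rule: stacking_induct)
    case (base f)
    then show ?case by (auto intro!: exI[of _ "[f]"] walk_singleton)
  next
    case (step S f h v)
    have c: "card (f \<inter> h) = d" using step card_Int_stacking[of f v h] by auto
    have to_f: "\<exists>fs. walk X d fs \<and> hd fs = g \<and> last fs = f" if g: "g \<in> S" for g
    proof -
      obtain fs where "walk X d fs" "hd fs = g" "last fs = h" using step g by blast
      then have "walk X d (fs @ [f])"
        using c step(2) by (intro walk_append walk_singleton) (auto simp: Int_commute)
      moreover have "hd (fs @ [f]) = g"
        using \<open>walk X d fs\<close> \<open>hd fs = g\<close> by (simp add: walk_def)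
      ultimately show ?thesis by (metis last_snoc)
    qed
    have from_f: "\<exists>fs. walk X d fs \<and> hd fs = f \<and> last fs = g" if "g \<in> S" for g
      using to_f[OF that] walk_rev by (metis hd_rev last_rev)
    have "\<exists>fs. walk X d fs \<and> hd fs = f \<and> last fs = f"
      using walk_singleton[OF step(2)] by (intro exI[of _ "[f]"]) simp
    then show ?case using to_f from_f step(7) by simp
  qed
  then show thesis using assms that by blast
qed

text \<open>If positions \<open>i < j\<close> had the same intersection, \<open>fs ! i\<close> and
  \<open>fs ! Suc j\<close> would both contain it, hence be equal or adjacent. The part between them
  could then be cut out.\<close>

lemma shortest_walk_is_path:
  assumes w: "walk X d fs"
    and min: "\<And>gs. walk X d gs \<Longrightarrow> hd gs = hd fs \<Longrightarrow> last gs = last fs \<Longrightarrow> length fs \<le> length gs"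
  shows "is_path X d fs"
proof -
  have False if ij: "i < j" "Suc j < length fs" and eq: "fs ! i \<inter> fs ! Suc i = fs ! j \<inter> fs ! Suc j" for i j
  proof -
    have mem: "fs ! i \<in> facets X" "fs ! Suc j \<in> facets X"
      using w ij by (auto simp: walk_def subset_iff)
    have wd: "walk X d (drop (Suc j) fs)" and hd: "hd (drop (Suc j) fs) = fs ! Suc j"
      using walk_drop[OF w] ij by (auto simp: hd_drop_conv_nth)
    show False
    proof (cases "fs ! i = fs ! Suc j")
      case True
      show False
      \<comment> \<open>The two facets coincide, so the prefix to keep ends before index
        \<open>i\<close>; for \<open>i = 0\<close> it is empty and the tail alone is the shorter
        walk.\<close>
      proof (cases i)
        case 0
        then have "length fs \<le> length (drop (Suc j) fs)"
          using wd hd True ij w by (intro min) (auto simp: hd_conv_nth walk_def)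
        then show False using ij by simp
      next
        case (Suc k)
        have "walk X d (take i fs @ drop (Suc j) fs)"
        proof (rule walk_append[OF walk_take[OF w] wd])
          have "last (take i fs) = fs ! k" using Suc ij last_take_Suc[of k fs] by simp
          moreover have "card (fs ! k \<inter> fs ! Suc k) = d" using w ij Suc by (simp add: walk_def)
          ultimately show "card (last (take i fs) \<inter> hd (drop (Suc j) fs)) = d"
            using Suc True hd by simp
        qed (use Suc in simp)
        then have "length fs \<le> length (take i fs @ drop (Suc j) fs)"
          using ij Suc by (intro min) (auto simp: hd_append)
        then show False using ij by simp
      qed
    next
      case False
      have "card (fs ! i \<inter> fs ! Suc i) = d" using w ij by (simp add: walk_def)
      then have "card (fs ! i \<inter> fs ! Suc j) = d"
        using card_Int_eqI[of "fs ! i" "fs ! Suc j" d "fs ! i \<inter> fs ! Suc i"] mem card_facet finite_facet False eq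
        by (metis Int_lower1 Int_lower2)
      moreover have "last (take (Suc i) fs) = fs ! i" using ij last_take_Suc[of i fs] by simp
      ultimately have "walk X d (take (Suc i) fs @ drop (Suc j) fs)"
        using hd by (intro walk_append[OF walk_take[OF w] wd]) auto
      then have "length fs \<le> length (take (Suc i) fs @ drop (Suc j) fs)"
        using ij by (intro min) (auto simp: hd_append)
      then show False using ij by simp
    qed
  qed
  then have "inj_on (\<lambda>i. fs ! i \<inter> fs ! Suc i) {0..<length fs - 1}"
    by (intro linorder_inj_onI') fastforce
  then show ?thesis using w by (simp add: is_path_def distinct_map)
qed

text \<open>The facet of a path that comes last in the stacking order can only be an end of the path,
  since its new vertex lies in no other facet of the path.\<close>

lemma path_no_return:
  assumes path: "is_path X d fs" and len: "3 \<le> length fs"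
    and v: "v \<in> hd fs" "v \<in> last fs"
  shows "\<exists>i. 0 < i \<and> i < length fs - 1 \<and> v \<in> fs ! i"
proof (rule ccontr)
  assume no: "\<not> ?thesis"
  have w: "walk X d fs" using path by (simp add: is_path_def)
  define m where "m = length fs - 1"
  have no': "v \<notin> fs ! i" if "0 < i" "i < m" for i using no that by (auto simp: m_def)
  have m: "2 \<le> m" "length fs = Suc m" using len by (auto simp: m_def)
  have "fs \<noteq> []" using len by auto
  then have ends: "hd fs = fs ! 0" "last fs = fs ! m"
    by (simp_all add: hd_conv_nth last_conv_nth m_def)
  have mem: "fs ! i \<in> facets X" if "i \<le> m" for i using w m that by (auto simp: walk_def subset_iff)
  have adj: "card (fs ! i \<inter> fs ! Suc i) = d" if "i < m" for i using w m that by (simp add: walk_def)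
  have dist: "i = j" if "fs ! i \<inter> fs ! Suc i = fs ! j \<inter> fs ! Suc j" "i < m" "j < m" for i j
    using path m that by (auto simp: is_path_def distinct_map inj_on_def)
  obtain os where os: "os \<noteq> []" "distinct os" "set os = facets X"
    "\<And>p. 0 < p \<Longrightarrow> p < length os \<Longrightarrow>
      \<exists>v j. os ! p - \<Union>(set (take p os)) = {v} \<and> j < p \<and> os ! p - {v} \<subseteq> os ! j"
    using stacking_order by blast
  define ix where "ix f = (THE k. k < length os \<and> os ! k = f)" for f
  have ix: "ix f < length os \<and> os ! ix f = f" if "f \<in> facets X" for f
    unfolding ix_def by (rule theI') (use that os distinct_Ex1 in metis)
  \<comment> \<open>At \<open>t\<close> the path is at its latest facet in the stacking
    order.\<close>
  obtain t where t: "t \<le> m" "\<And>i. i \<le> m \<Longrightarrow> ix (fs ! i) \<le> ix (fs ! t)"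
    using ex_has_greatest_nat[of "\<lambda>i. i \<le> m" 0 "\<lambda>i. ix (fs ! i)" "length os"] ix mem
    by (metis less_imp_le zero_le)
  define f where "f = fs ! t"
  have f: "f \<in> facets X" using t mem by (simp add: f_def)
  have neq: "fs ! i \<noteq> fs ! Suc i" if "i < m" for i
    using adj[OF that] card_facet[OF mem[of i]] that by auto
  have other: "ix (fs ! i) < ix f" if "i \<le> m" "fs ! i \<noteq> f" for i
    using t(2)[OF that(1)] that ix mem f unfolding f_def by (metis le_neq_implies_less)
  have "\<exists>i\<le>m. fs ! i \<noteq> f"
    using neq[of 0] m by (metis Suc_leI le0 less_le_trans pos2)
  \<comment> \<open>Not being first in the order, \<open>f\<close> brought a new vertex, called
    \<open>x\<close> below.\<close>
  then have pos: "0 < ix f" using other by fastforce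
  obtain x where x: "f - \<Union>(set (take (ix f) os)) = {x}"
    using os(4)[OF pos] ix[OF f] by auto
  \<comment> \<open>Nothing so far prevents the path from visiting \<open>f\<close> several times,
    so the exception is stated for the facet \<open>f\<close> and not for the index
    \<open>t\<close>.\<close>
  have x_only: "x \<notin> fs ! i" if "i \<le> m" "fs ! i \<noteq> f" for i
  proof -
    have "fs ! i \<in> set (take (ix f) os)"
      using other[OF that] ix[OF mem[OF that(1)]] ix[OF f] by (auto simp: in_set_conv_nth)
    then show ?thesis using x by auto
  qed
  have xf: "x \<in> f" using x by auto
  have int: "f \<inter> g = f - {x}" if "card (f \<inter> g) = d" "x \<notin> g" for g
  proof (rule card_subset_eq)
    show "card (f \<inter> g) = card (f - {x})" using that xf card_facet[OF f] by simp
  qed (use finite_facet[OF f] that in auto)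
  have next_int: "fs ! i \<inter> fs ! Suc i = f - {x}" if "i < m" and eq: "fs ! i = f \<or> fs ! Suc i = f" for i
  proof -
    consider "fs ! i = f" "fs ! Suc i \<noteq> f" | "fs ! Suc i = f" "fs ! i \<noteq> f"
      using eq neq[OF \<open>i < m\<close>] by metis
    then show ?thesis
    proof cases
      case 1
      then show ?thesis using int[of "fs ! Suc i"] adj[OF that(1)] x_only[of "Suc i"] that(1) by simp
    next
      case 2
      then show ?thesis
        using int[of "fs ! i"] adj[OF that(1)] x_only[of i] that(1) by (simp add: Int_commute)
    qed
  qed
  \<comment> \<open>At an interior \<open>t\<close> the intersections before and after
    \<open>f\<close> would both be \<open>f - {x}\<close>, which a path forbids.\<close>
  have "t = 0 \<or> t = m"
  proof (rule ccontr)
    assume "\<not> ?thesis"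
    then have "t - 1 < m" "t < m" "Suc (t - 1) = t" "t - 1 \<noteq> t" using t(1) by auto
    then show False using next_int[of "t - 1"] next_int[of t] dist[of "t - 1" t] by (simp add: f_def)
  qed
  then show False
  proof
    \<comment> \<open>If \<open>f\<close> starts the path, \<open>v\<close> misses the next facet
      and must be \<open>x\<close>. But \<open>v\<close> lies in the last facet too, so that facet
      is again \<open>f\<close>, and the first and last intersections coincide; their indices
      \<open>0\<close> and \<open>m - 1\<close> differ because \<open>m\<close> is at least 2. The
      other end is symmetric.\<close>
    assume "t = 0"
    then have f0: "f = fs ! 0" by (simp add: f_def)
    have "v \<notin> fs ! 1" using no' m by simp
    moreover have "fs ! 0 \<inter> fs ! 1 = f - {x}" using next_int[of 0] f0 m by auto
    ultimately have "v = x" using v ends f0 by auto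
    then have "fs ! m = f" using x_only[of m] v ends by auto
    then show False using next_int[of "m - 1"] next_int[of 0] dist[of 0 "m - 1"] m f0 by auto
  next
    assume "t = m"
    then have fm: "f = fs ! m" by (simp add: f_def)
    have "v \<notin> fs ! (m - 1)" using no' m by simp
    moreover have "fs ! (m - 1) \<inter> fs ! m = f - {x}" using next_int[of "m - 1"] fm m by auto
    ultimately have "v = x" using v ends fm by auto
    then have "fs ! 0 = f" using x_only[of 0] v ends by auto
    then show False using next_int[of "m - 1"] next_int[of 0] dist[of 0 "m - 1"] m fm by auto
  qed
qed

lemma walk_ends_differ:
  assumes w: "walk X d fs" and len: "length fs = Suc m" "0 < m"
  obtains v u where "fs ! 0 - fs ! 1 = {v}" "fs ! m - fs ! (m - 1) = {u}"
proof -
  have adj: "card (fs ! 0 \<inter> fs ! 1) = d" "card (fs ! m \<inter> fs ! (m - 1)) = d"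
    using w len by (auto simp: walk_def Int_commute dest!: spec[of _ "m - 1"])
  have mem: "fs ! 0 \<in> facets X" "fs ! m \<in> facets X" using w len by (auto simp: walk_def subset_iff)
  obtain v where "fs ! 0 - fs ! 1 = {v}"
    by (rule Diff_singleton_of_card_Int[OF finite_facet[OF mem(1)] card_facet[OF mem(1)] adj(1)])
  moreover obtain u where "fs ! m - fs ! (m - 1) = {u}"
    by (rule Diff_singleton_of_card_Int[OF finite_facet[OF mem(2)] card_facet[OF mem(2)] adj(2)])
  ultimately show thesis by (rule that)
qed

end

subsection \<open>Couplings of vertex colourings and facet labellings\<close>

locale coupling = stacked_complex +
  fixes c :: "'a \<Rightarrow> 'n" and \<phi> :: "'a set \<Rightarrow> 'r" and \<alpha> :: "'a set \<Rightarrow> 'n \<Rightarrow> 'r"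
    and N :: "'n set" and R :: "'r set"
  assumes coupled: "coupled d (facets X) c \<phi> \<alpha> N R"
begin

lemma
  assumes "f \<in> facets X"
  shows inj_on_facet: "inj_on c f"
    and image_subset: "c ` f \<subseteq> N"
    and label_in: "\<phi> f \<in> R"
  using coupled assms by (auto simp: coupled_def)

text \<open>Missing colours are sent into \<open>R - {\<phi> f}\<close>, so comparison with the
  label of \<open>f\<close> detects whether a colour occurs in \<open>f\<close>. All translations
  between colours and labels go through this test.\<close>

lemma alpha_eq_label_iff:
  assumes "f \<in> facets X" "P \<in> N"
  shows "\<alpha> f P = \<phi> f \<longleftrightarrow> P \<in> c ` f"
proof -
  have "\<forall>P\<in>c ` f. \<alpha> f P = \<phi> f" "bij_betw (\<alpha> f) (N - c ` f) (R - {\<phi> f})"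
    using coupled assms by (auto simp: coupled_def)
  then show ?thesis using assms(2) by (auto dest: bij_betwE)
qed

lemma alpha_surj:
  assumes "f \<in> facets X"
  shows "\<alpha> f ` N = R"
proof -
  have f: "c ` f \<subseteq> N" "\<phi> f \<in> R" "\<forall>P\<in>c ` f. \<alpha> f P = \<phi> f" "bij_betw (\<alpha> f) (N - c ` f) (R - {\<phi> f})"
    using coupled assms by (auto simp: coupled_def)
  have "c ` f \<noteq> {}" using card_facet[OF assms] by auto
  then have "\<alpha> f ` c ` f = {\<phi> f}" using f(3) image_constant_conv[of "\<phi> f" "c ` f"]
    by (metis image_cong)
  moreover have "\<alpha> f ` (N - c ` f) = R - {\<phi> f}" using f(4) by (simp add: bij_betw_def)
  moreover have "N = c ` f \<union> (N - c ` f)" using f(1) by auto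
  ultimately show ?thesis using f(2) by (metis image_Un insert_Diff insert_is_Un)
qed

lemma alpha_adjacent:
  assumes "f \<in> facets X" "g \<in> facets X" "card (f \<inter> g) = d" "P \<in> N" "P \<notin> c ` (f \<inter> g)"
  shows "\<alpha> f P = \<alpha> g P"
  using coupled assms by (auto simp: coupled_def)

text \<open>The value of a fixed colour can change only across a common face containing that colour.
  The premise has to hold only while the value is still the initial one, because some applications
  deduce the absence of \<open>P\<close> from that very value.\<close>

lemma alpha_walk:
  assumes "walk X d fs" "P \<in> N"
    and "\<And>j. j < i \<Longrightarrow> \<alpha> (fs ! j) P = \<alpha> (fs ! 0) P \<Longrightarrow> P \<notin> c ` (fs ! j \<inter> fs ! Suc j)"
    and "i < length fs"
  shows "\<alpha> (fs ! i) P = \<alpha> (fs ! 0) P"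
  using assms(3,4)
proof (induction i)
  case (Suc i)
  have "\<alpha> (fs ! i) P = \<alpha> (fs ! 0) P" using Suc by simp
  moreover have "P \<notin> c ` (fs ! i \<inter> fs ! Suc i)" using Suc.prems(1)[of i] calculation by simp
  ultimately show ?case
    using alpha_adjacent[of "fs ! i" "fs ! Suc i" P] assms(1,2) Suc.prems(2) by (auto simp: walk_def subset_iff)
qed simp

text \<open>The left-hand side is the condition in the definition of \<open>\<Phi>\<close>, the right-hand side the one
  in the definition of \<open>\<Psi>\<close>.\<close>

lemma walk_ends_iff:
  assumes w: "walk X d fs" and len: "length fs = Suc m" "0 < m"
    and v: "v \<in> fs ! 0" "v \<notin> fs ! 1" and u: "u \<in> fs ! m" "u \<notin> fs ! (m - 1)"
  shows "c v = c u \<and> (\<forall>i. 0 < i \<and> i < m \<longrightarrow> c v \<notin> c ` (fs ! i)) \<longleftrightarrow>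
    \<phi> (fs ! 0) = \<phi> (fs ! m) \<and> (\<forall>i. 0 < i \<and> i < m \<longrightarrow> \<phi> (fs ! i) \<noteq> \<phi> (fs ! 0))"
    (is "?L \<longleftrightarrow> ?Rt")
proof -
  have mem: "fs ! i \<in> facets X" if "i \<le> m" for i using w len that by (auto simp: walk_def subset_iff)
  have adj: "card (fs ! i \<inter> fs ! Suc i) = d" if "i < m" for i using w len that by (simp add: walk_def)
  define P where "P = c v"
  have P: "P \<in> N" using v image_subset[OF mem[of 0]] by (auto simp: P_def)
  \<comment> \<open>In the first facet only \<open>v\<close> has colour \<open>P\<close>, and
    \<open>v\<close> is not in the next one.\<close>
  have P0: "P \<notin> c ` (fs ! 0 \<inter> fs ! Suc 0)"
    using v inj_on_facet[OF mem[of 0]] by (auto simp: P_def inj_on_def)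
  have a0: "\<alpha> (fs ! 0) P = \<phi> (fs ! 0)"
    using alpha_eq_label_iff[OF mem[of 0] P] v by (simp add: P_def)
  have um: "x = u" if "x \<in> fs ! m" "x \<notin> fs ! (m - 1)" for x
  proof -
    have "card (fs ! m \<inter> fs ! (m - 1)) = d" using adj[of "m - 1"] len by (simp add: Int_commute)
    then obtain y where "fs ! m - fs ! (m - 1) = {y}"
      using Diff_singleton_of_card_Int[of "fs ! m"] finite_facet card_facet mem[of m] by blast
    then have "x \<in> {y}" "u \<in> {y}" using that u by blast+
    then show ?thesis by simp
  qed
  show ?thesis
  proof
    assume L: ?L
    have notin: "P \<notin> c ` (fs ! j \<inter> fs ! Suc j)" if "j < m" for j
    proof (cases "j = 0")
      case False
      then show ?thesis using L that by (auto simp: P_def)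
    qed (use P0 in simp)
    have all: "\<alpha> (fs ! i) P = \<phi> (fs ! 0)" if "i \<le> m" for i
      using alpha_walk[OF w P, of i] notin that len a0 by simp
    show ?Rt
    proof (intro conjI allI impI)
      have "P \<in> c ` (fs ! m)" using L u by (auto simp: P_def)
      then show "\<phi> (fs ! 0) = \<phi> (fs ! m)" using all[of m] alpha_eq_label_iff[OF mem[of m] P] by simp
      fix i assume i: "0 < i \<and> i < m"
      then have "P \<notin> c ` (fs ! i)" using L by (auto simp: P_def)
      then show "\<phi> (fs ! i) \<noteq> \<phi> (fs ! 0)"
        using all[of i] alpha_eq_label_iff[OF mem[of i] P] i by auto
    qed
  next
    assume Rt: ?Rt
    \<comment> \<open>While the carried value is still \<open>\<phi> (fs ! 0)\<close>, an interior
      facet containing the colour \<open>P\<close> would have that label, against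
      \<open>Rt\<close>.\<close>
    have sep: "P \<notin> c ` (fs ! j)" if "0 < j" "j < m" "\<alpha> (fs ! j) P = \<alpha> (fs ! 0) P" for j
      using Rt that a0 alpha_eq_label_iff[OF mem[of j] P] by auto
    have notin: "P \<notin> c ` (fs ! j \<inter> fs ! Suc j)" if "j < m" "\<alpha> (fs ! j) P = \<alpha> (fs ! 0) P" for j
    proof (cases "j = 0")
      case False
      then show ?thesis using sep[of j] that by auto
    qed (use P0 in simp)
    have all: "\<alpha> (fs ! i) P = \<alpha> (fs ! 0) P" if "i \<le> m" for i
      using alpha_walk[OF w P, of i] notin that len by simp
    have "\<alpha> (fs ! m) P = \<phi> (fs ! m)" using all[of m] a0 Rt by simp
    then obtain x where x: "x \<in> fs ! m" "c x = P" using alpha_eq_label_iff[OF mem[of m] P] by auto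
    \<comment> \<open>The colour \<open>P\<close> occurs in the last facet but not in the face
      shared with its predecessor, so it sits at the only vertex outside that face, namely
      \<open>u\<close>.\<close>
    have "P \<notin> c ` (fs ! (m - 1) \<inter> fs ! m)" using notin[of "m - 1"] all[of "m - 1"] len by simp
    then have "x \<notin> fs ! (m - 1)" using x by auto
    then have "x = u" using um x by blast
    then have "c v = c u" using x(2) by (simp add: P_def)
    moreover have "c v \<notin> c ` (fs ! i)" if "0 < i" "i < m" for i
      using sep[of i] all[of i] that unfolding P_def by simp
    ultimately show ?L by blast
  qed
qed

lemma label_surj:
  assumes "c ` vertices X = N"
  shows "\<phi> ` facets X = R"
proof
  show "\<phi> ` facets X \<subseteq> R" using label_in by auto
  show "R \<subseteq> \<phi> ` facets X"
  proof (rule ccontr)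
    assume "\<not> ?thesis"
    then obtain Q where Q: "Q \<in> R" "Q \<notin> \<phi> ` facets X" by auto
    obtain f where f: "f \<in> facets X" using stacking_order by (metis list.set_sel(1))
    obtain P where P: "P \<in> N" "\<alpha> f P = Q" using alpha_surj[OF f] Q by auto
    obtain u where "u \<in> vertices X" "c u = P" using P assms by auto
    then obtain g where g: "g \<in> facets X" "P \<in> c ` g" unfolding vertices_eq_Union_facets by auto
    obtain fs where fs: "walk X d fs" "hd fs = f" "last fs = g" using exists_walk[OF f g(1)] by blast
    have ne: "fs \<noteq> []" using fs by (simp add: walk_def)
    have mem: "fs ! i \<in> facets X" if "i < length fs" for i using fs that by (auto simp: walk_def subset_iff)
    have f0: "fs ! 0 = f" using fs ne by (simp add: hd_conv_nth)
    have gm: "fs ! (length fs - 1) = g" using fs ne by (simp add: last_conv_nth)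
    have "\<alpha> (fs ! (length fs - 1)) P = \<alpha> (fs ! 0) P"
    proof (rule alpha_walk[OF fs(1) P(1)])
      fix j assume "j < length fs - 1" "\<alpha> (fs ! j) P = \<alpha> (fs ! 0) P"
      then have "\<alpha> (fs ! j) P = Q" "fs ! j \<in> facets X" using f0 P(2) mem by auto
      then have "P \<notin> c ` (fs ! j)" using alpha_eq_label_iff[OF _ P(1)] Q(2) by blast
      then show "P \<notin> c ` (fs ! j \<inter> fs ! Suc j)" by auto
    qed (use ne in simp)
    then have "\<alpha> g P = Q" using f0 gm P by simp
    then show False using alpha_eq_label_iff[OF g(1) P(1)] g Q by auto
  qed
qed

lemma colour_surj:
  assumes "\<phi> ` facets X = R"
  shows "c ` vertices X = N"
proof
  show "c ` vertices X \<subseteq> N" using image_subset unfolding vertices_eq_Union_facets by auto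
  show "N \<subseteq> c ` vertices X"
  proof (rule ccontr)
    assume "\<not> ?thesis"
    then obtain P where P: "P \<in> N" "P \<notin> c ` vertices X" by auto
    have notin: "P \<notin> c ` f" if "f \<in> facets X" for f
      using P that unfolding vertices_eq_Union_facets by auto
    obtain f where f: "f \<in> facets X" using stacking_order by (metis list.set_sel(1))
    have "\<alpha> f P \<in> \<phi> ` facets X" using alpha_surj[OF f] P assms by auto
    then obtain g where g: "g \<in> facets X" "\<phi> g = \<alpha> f P" by auto
    obtain fs where fs: "walk X d fs" "hd fs = f" "last fs = g" using exists_walk[OF f g(1)] by blast
    have ne: "fs \<noteq> []" using fs by (simp add: walk_def)
    have "\<alpha> (fs ! (length fs - 1)) P = \<alpha> (fs ! 0) P"
    proof (rule alpha_walk[OF fs(1) P(1)])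
      fix j assume "j < length fs - 1"
      then have "fs ! j \<in> facets X" using fs by (auto simp: walk_def subset_iff)
      then show "P \<notin> c ` (fs ! j \<inter> fs ! Suc j)" using notin by blast
    qed (use ne in simp)
    then have "\<alpha> g P = \<phi> g" using fs ne g by (simp add: hd_conv_nth last_conv_nth)
    then show False using alpha_eq_label_iff[OF g(1) P(1)] notin g by auto
  qed
qed

section \<open>The maps \<open>Phi\<close> and \<open>Psi\<close> on the fibres of a
  coupling\<close>

lemma PhiRel_fibresI:
  assumes path: "is_path X d fs" and len: "length fs = Suc m" "0 < m"
    and ends: "fs ! 0 \<noteq> fs ! m" "\<phi> (fs ! 0) = \<phi> (fs ! m)"
    and int: "\<And>i. 0 < i \<Longrightarrow> i < m \<Longrightarrow> \<phi> (fs ! i) \<noteq> \<phi> (fs ! 0)"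
  shows "(fs ! 0, fs ! m) \<in> PhiRel X d (fibres c (vertices X))"
proof -
  have w: "walk X d fs" using path by (simp add: is_path_def)
  obtain v u where vu: "fs ! 0 - fs ! 1 = {v}" "fs ! m - fs ! (m - 1) = {u}"
    using walk_ends_differ[OF w len] by blast
  have K: "c v = c u" "\<And>i. 0 < i \<Longrightarrow> i < m \<Longrightarrow> c v \<notin> c ` (fs ! i)"
    using walk_ends_iff[OF w len, of v u] vu ends int by blast+
  have mem: "fs ! i \<in> facets X" if "i \<le> m" for i using w len that by (auto simp: walk_def subset_iff)
  have V: "v \<in> vertices X" "u \<in> vertices X"
    using vu mem[of 0] mem[of m] unfolding vertices_eq_Union_facets by auto
  define P where "P = {y \<in> vertices X. c y = c v}"
  have "P \<in> fibres c (vertices X)" "v \<in> P" "u \<in> P" using V K(1) by (auto simp: P_def fibres_def)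
  moreover have "fs ! i \<inter> P = {}" if "0 < i" "i < m" for i
    using K(2)[OF that] unfolding P_def by (smt (verit) disjoint_iff imageI mem_Collect_eq)
  moreover have "fs \<noteq> []" using len by auto
  then have "hd fs = fs ! 0" "last fs = fs ! m" using len by (simp_all add: hd_conv_nth last_conv_nth)
  ultimately show ?thesis
    unfolding PhiRel_def mem_Collect_eq case_prod_conv
    using path len ends(1) vu mem[of 0] mem[of m]
    by (intro conjI exI[of _ fs] exI[of _ v] exI[of _ u] bexI[of _ P]) simp_all
qed

lemma PsiRel_fibresI:
  assumes path: "is_path X d fs" and len: "length fs = Suc m" "0 < m"
    and v: "v \<in> fs ! 0" "v \<notin> fs ! 1" and u: "u \<in> fs ! m" "u \<notin> fs ! (m - 1)"
    and vu: "v \<noteq> u" "c v = c u"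
    and int: "\<And>i. 0 < i \<Longrightarrow> i < m \<Longrightarrow> c v \<notin> c ` (fs ! i)"
  shows "(v, u) \<in> PsiRel X d (fibres \<phi> (facets X))"
proof -
  have w: "walk X d fs" using path by (simp add: is_path_def)
  have K: "\<phi> (fs ! 0) = \<phi> (fs ! m)" "\<And>i. 0 < i \<Longrightarrow> i < m \<Longrightarrow> \<phi> (fs ! i) \<noteq> \<phi> (fs ! 0)"
    using walk_ends_iff[OF w len v u] vu int by blast+
  have mem: "fs ! i \<in> facets X" if "i \<le> m" for i using w len that by (auto simp: walk_def subset_iff)
  have V: "v \<in> vertices X" "u \<in> vertices X"
    using v u mem[of 0] mem[of m] unfolding vertices_eq_Union_facets by auto
  have sep: "\<not> (\<exists>f\<in>facets X. v \<in> f \<and> u \<in> f)"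
    using inj_on_facet vu by (meson inj_onD)
  define Q where "Q = {g \<in> facets X. \<phi> g = \<phi> (fs ! 0)}"
  have "Q \<in> fibres \<phi> (facets X)" "fs ! 0 \<in> Q" "fs ! m \<in> Q"
    using mem[of 0] mem[of m] K(1) by (auto simp: Q_def fibres_def)
  moreover have "fs ! i \<notin> Q" if "0 < i" "i < m" for i
    using K(2)[OF that] by (auto simp: Q_def)
  moreover have "fs \<noteq> []" using len by auto
  then have "hd fs = fs ! 0" "last fs = fs ! m" using len by (simp_all add: hd_conv_nth last_conv_nth)
  ultimately show ?thesis
    unfolding PsiRel_def mem_Collect_eq case_prod_conv
    using path len V sep vu(1) v u
    by (intro conjI exI[of _ fs] bexI[of _ Q]) simp_all
qed

lemma PhiRel_fibresD:
  assumes "(f, f') \<in> PhiRel X d (fibres c (vertices X))"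
  shows "f \<in> facets X \<and> f' \<in> facets X \<and> \<phi> f = \<phi> f'"
proof -
  obtain fs v u P where fs: "f \<in> facets X" "f' \<in> facets X" "is_path X d fs" "hd fs = f" "last fs = f'"
    "2 \<le> length fs" "fs ! 0 - fs ! 1 = {v}" "last fs - fs ! (length fs - 2) = {u}"
    and P: "P \<in> fibres c (vertices X)" "v \<in> P" "u \<in> P"
    "\<And>i. 1 \<le> i \<and> i < length fs - 1 \<Longrightarrow> fs ! i \<inter> P = {}"
    using assms unfolding PhiRel_def by auto
  define m where "m = length fs - 1"
  have len: "length fs = Suc m" "0 < m" "length fs - 2 = m - 1" using fs(6) by (auto simp: m_def)
  have w: "walk X d fs" using fs(3) by (simp add: is_path_def)
  have ends: "f = fs ! 0" "f' = fs ! m"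
    using fs(4,5) w by (auto simp: hd_conv_nth last_conv_nth m_def walk_def)
  have Pv: "P = {y \<in> vertices X. c y = c v}" using P(1,2) by (auto simp: fibres_def)
  have "c v = c u" using P(3) Pv by auto
  moreover have "c v \<notin> c ` (fs ! i)" if "0 < i" "i < m" for i
  proof -
    have "fs ! i \<subseteq> vertices X"
      using w len that unfolding vertices_eq_Union_facets by (auto simp: walk_def subset_iff)
    moreover have "fs ! i \<inter> P = {}" using P(4)[of i] that by (simp add: m_def)
    ultimately show ?thesis using Pv by auto
  qed
  moreover have "v \<in> fs ! 0" "v \<notin> fs ! 1" "u \<in> fs ! m" "u \<notin> fs ! (m - 1)"
    using fs(5,7,8) ends len by auto
  ultimately have "\<phi> (fs ! 0) = \<phi> (fs ! m)" using walk_ends_iff[OF w len(1,2), of v u] by simp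
  then show ?thesis using ends fs(1,2) by simp
qed

lemma PsiRel_fibresD:
  assumes "(v, u) \<in> PsiRel X d (fibres \<phi> (facets X))"
  shows "v \<in> vertices X \<and> u \<in> vertices X \<and> c v = c u"
proof -
  obtain fs Q where V: "v \<in> vertices X" "u \<in> vertices X" "\<not> (\<exists>f\<in>facets X. v \<in> f \<and> u \<in> f)"
    and fs: "is_path X d fs" "v \<in> hd fs" "u \<in> last fs"
    "2 \<le> length fs \<Longrightarrow> v \<notin> fs ! 0 \<inter> fs ! 1 \<and> u \<notin> last fs \<inter> fs ! (length fs - 2)"
    and Q: "Q \<in> fibres \<phi> (facets X)" "hd fs \<in> Q" "last fs \<in> Q"
    "\<And>i. 1 \<le> i \<and> i < length fs - 1 \<Longrightarrow> fs ! i \<notin> Q"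
    using assms unfolding PsiRel_def by auto
  have w: "walk X d fs" and ne: "fs \<noteq> []" using fs(1) by (auto simp: is_path_def walk_def)
  define m where "m = length fs - 1"
  have ends: "hd fs = fs ! 0" "last fs = fs ! m"
    using ne by (auto simp: hd_conv_nth last_conv_nth m_def)
  have "fs ! 0 \<in> facets X" using w ne by (auto simp: walk_def subset_iff)
  \<comment> \<open>A path of one facet would put \<open>v\<close> and \<open>u\<close> in a common
    facet, which the relation excludes. Hence the end conditions for longer paths apply.\<close>
  then have "m \<noteq> 0" using V(3) fs(2,3) ends by auto
  then have len: "length fs = Suc m" "0 < m" "length fs - 2 = m - 1" "2 \<le> length fs" by (auto simp: m_def)
  have Q0: "Q = {g \<in> facets X. \<phi> g = \<phi> (fs ! 0)}" using Q(1,2) ends by (auto simp: fibres_def)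
  have "\<phi> (fs ! 0) = \<phi> (fs ! m)" using Q(3) Q0 ends by auto
  moreover have "\<phi> (fs ! i) \<noteq> \<phi> (fs ! 0)" if "0 < i" "i < m" for i
  proof -
    have "fs ! i \<in> facets X" using w len that by (auto simp: walk_def subset_iff)
    moreover have "fs ! i \<notin> Q" using Q(4)[of i] that by (simp add: m_def)
    ultimately show ?thesis using Q0 by auto
  qed
  moreover have "v \<in> fs ! 0" "v \<notin> fs ! 1" "u \<in> fs ! m" "u \<notin> fs ! (m - 1)"
    using fs(2-4) ends len by auto
  ultimately have "c v = c u" using walk_ends_iff[OF w len(1,2), of v u] by simp
  then show ?thesis using V(1,2) by simp
qed

text \<open>A walk between facets of equal label is replaced by a shorter one with the same ends, or
  split at an interior facet of that label. When neither is possible, it is a path whose ends are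
  directly related, unless they are equal.\<close>

lemma Phi_fibres: "Phi X d (fibres c (vertices X)) = fibres \<phi> (facets X)"
proof -
  let ?T = "PhiRel X d (fibres c (vertices X))"
  have cl: "(hd fs, last fs) \<in> (?T \<union> ?T\<inverse>)\<^sup>*" if "walk X d fs" "\<phi> (hd fs) = \<phi> (last fs)" for fs
    using that
  proof (induction "length fs" arbitrary: fs rule: less_induct)
    case less
    note w = less.prems(1)
    have ne: "fs \<noteq> []" using w by (simp add: walk_def)
    define m where "m = length fs - 1"
    have len: "length fs = Suc m" using ne by (simp add: m_def)
    have ends: "hd fs = fs ! 0" "last fs = fs ! m"
      using ne by (auto simp: hd_conv_nth last_conv_nth m_def)
    consider "hd fs = last fs"
      | gs where "walk X d gs" "hd gs = hd fs" "last gs = last fs" "length gs < length fs"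
      | i where "0 < i" "i < m" "\<phi> (fs ! i) = \<phi> (fs ! 0)"
      | "hd fs \<noteq> last fs" "\<And>i. 0 < i \<Longrightarrow> i < m \<Longrightarrow> \<phi> (fs ! i) \<noteq> \<phi> (fs ! 0)"
        "\<And>gs. walk X d gs \<Longrightarrow> hd gs = hd fs \<Longrightarrow> last gs = last fs \<Longrightarrow> length fs \<le> length gs"
      by (meson not_le)
    then show ?case
    proof cases
      case (2 gs)
      then show ?thesis using less.hyps[of gs] less.prems(2) by simp
    next
      case (3 i)
      have "(hd (take (Suc i) fs), last (take (Suc i) fs)) \<in> (?T \<union> ?T\<inverse>)\<^sup>*"
        using 3 len ends walk_take[OF w, of "Suc i"] last_take_Suc[of i fs] by (intro less.hyps) auto
      moreover have "(hd (drop i fs), last (drop i fs)) \<in> (?T \<union> ?T\<inverse>)\<^sup>*"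
        using 3 len ends less.prems(2) walk_drop[OF w, of i]
        by (intro less.hyps) (auto simp: hd_drop_conv_nth)
      ultimately show ?thesis
        using 3 len last_take_Suc[of i fs] by (auto simp: hd_drop_conv_nth)
    next
      case 4
      have "0 < m" using 4(1) ends by (cases m) auto
      moreover have "is_path X d fs" using shortest_walk_is_path[OF w] 4(3) by blast
      ultimately have "(fs ! 0, fs ! m) \<in> ?T"
        using PhiRel_fibresI[OF _ len] 4 ends less.prems(2) by simp
      then show ?thesis using ends by auto
    qed simp
  qed
  show ?thesis
    unfolding Phi_def
  proof (rule quotient_eq_fibres)
    fix f g assume fg: "f \<in> facets X" "g \<in> facets X" "\<phi> f = \<phi> g"
    obtain fs where "walk X d fs" "hd fs = f" "last fs = g" using exists_walk[OF fg(1,2)] by blast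
    then show "(f, g) \<in> (?T \<union> ?T\<inverse>)\<^sup>*" using cl[of fs] fg(3) by simp
  qed (use PhiRel_fibresD in auto)
qed

lemma Psi_fibres: "Psi X d (fibres \<phi> (facets X)) = fibres c (vertices X)"
proof -
  let ?T = "PsiRel X d (fibres \<phi> (facets X))"
  have cl: "(v, u) \<in> (?T \<union> ?T\<inverse>)\<^sup>*"
    if "walk X d fs" "v \<in> hd fs" "u \<in> last fs" "c v = c u" for fs v u
    using that
  proof (induction "length fs" arbitrary: fs v u rule: less_induct)
    case less
    note w = less.prems(1)
    have ne: "fs \<noteq> []" using w by (simp add: walk_def)
    define m where "m = length fs - 1"
    have len: "length fs = Suc m" using ne by (simp add: m_def)
    have ends: "hd fs = fs ! 0" "last fs = fs ! m"
      using ne by (auto simp: hd_conv_nth last_conv_nth m_def)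
    have left: "(v, x) \<in> (?T \<union> ?T\<inverse>)\<^sup>*" if "i < m" "x \<in> fs ! i" "c x = c v" for i x
      using that len less.prems walk_take[OF w, of "Suc i"] last_take_Suc[of i fs]
      by (intro less.hyps[of "take (Suc i) fs"]) auto
    have right: "(x, u) \<in> (?T \<union> ?T\<inverse>)\<^sup>*" if "0 < i" "i \<le> m" "x \<in> fs ! i" "c x = c v" for i x
      using that len less.prems walk_drop[OF w, of i]
      by (intro less.hyps[of "drop i fs"]) (auto simp: hd_drop_conv_nth)
    consider "v = u"
      | gs where "walk X d gs" "hd gs = hd fs" "last gs = last fs" "length gs < length fs"
      | i x where "0 < i" "i < m" "x \<in> fs ! i" "c x = c v"
      | "0 < m" "v \<in> fs ! 1"
      | "0 < m" "u \<in> fs ! (m - 1)"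
      | "v \<noteq> u" "\<And>i. 0 < i \<Longrightarrow> i < m \<Longrightarrow> c v \<notin> c ` (fs ! i)"
        "0 < m \<Longrightarrow> v \<notin> fs ! 1" "0 < m \<Longrightarrow> u \<notin> fs ! (m - 1)"
        "\<And>gs. walk X d gs \<Longrightarrow> hd gs = hd fs \<Longrightarrow> last gs = last fs \<Longrightarrow> length fs \<le> length gs"
      by (metis imageE not_le)
    then show ?case
    proof cases
      case (2 gs)
      then show ?thesis using less.hyps[of gs] less.prems by simp
    next
      case (3 i x)
      then show ?thesis using left[of i x] right[of i x] by (meson less_imp_le rtrancl_trans)
    next
      case 4
      then show ?thesis using right[of 1 v] by simp
    next
      case 5
      then show ?thesis using left[of "m - 1" u] less.prems(4) by simp
    next
      case 6
      have "fs ! 0 \<in> facets X" using w ne by (auto simp: walk_def subset_iff)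
      then have "0 < m"
        using 6(1) less.prems ends inj_on_facet by (metis gr0I inj_onD)
      moreover have "is_path X d fs" using shortest_walk_is_path[OF w] 6(5) by blast
      ultimately have "(v, u) \<in> ?T"
        using PsiRel_fibresI[OF _ len] 6(1-4) ends less.prems by simp
      then show ?thesis by auto
    qed simp
  qed
  show ?thesis
    unfolding Psi_def
  proof (rule quotient_eq_fibres)
    fix v u assume vu: "v \<in> vertices X" "u \<in> vertices X" "c v = c u"
    obtain f g where fg: "f \<in> facets X" "v \<in> f" "g \<in> facets X" "u \<in> g"
      using vu unfolding vertices_eq_Union_facets by auto
    obtain fs where "walk X d fs" "hd fs = f" "last fs = g" using exists_walk[OF fg(1,3)] by blast
    then show "(v, u) \<in> (?T \<union> ?T\<inverse>)\<^sup>*" using cl[of fs v u] vu(3) fg by simp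
  qed (use PsiRel_fibresD in auto)
qed

section \<open>Comparison of scatteredness\<close>

lemma facet_walk_length:
  assumes scat: "\<And>fs v u. walk X d fs \<Longrightarrow> v \<in> hd fs \<Longrightarrow> u \<in> last fs \<Longrightarrow> v \<noteq> u \<Longrightarrow> c v = c u \<Longrightarrow>
      Suc s \<le> length fs"
    and "walk X d fs" "hd fs \<noteq> last fs" "\<phi> (hd fs) = \<phi> (last fs)"
  shows "Suc s \<le> length fs"
  using assms(2-)
proof (induction "length fs" arbitrary: fs rule: less_induct)
  case less
  note w = less.prems(1)
  have ne: "fs \<noteq> []" using w by (simp add: walk_def)
  define m where "m = length fs - 1"
  have len: "length fs = Suc m" using ne by (simp add: m_def)
  have ends: "hd fs = fs ! 0" "last fs = fs ! m"
    using ne by (auto simp: hd_conv_nth last_conv_nth m_def)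
  have m0: "0 < m" using less.prems(2) ends by (cases m) auto
  show ?case
  proof (cases "\<exists>gs. walk X d gs \<and> hd gs = hd fs \<and> last gs = last fs \<and> length gs < length fs")
    case True
    then obtain gs where "walk X d gs" "hd gs = hd fs" "last gs = last fs" "length gs < length fs" by blast
    then show ?thesis using less.hyps[of gs] less.prems by simp
  next
    case short: False
    have path: "is_path X d fs"
      using shortest_walk_is_path[OF w] short by (meson not_le)
    show ?thesis
    proof (cases "\<exists>i. 0 < i \<and> i < m \<and> \<phi> (fs ! i) = \<phi> (fs ! 0)")
      case True
      then obtain i where i: "0 < i" "i < m" "\<phi> (fs ! i) = \<phi> (fs ! 0)" by blast
      have d: "walk X d (drop i fs)" "hd (drop i fs) = fs ! i" "last (drop i fs) = last fs"
        using i len walk_drop[OF w, of i] by (auto simp: hd_drop_conv_nth)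
      have "hd (drop i fs) \<noteq> last (drop i fs) \<Longrightarrow> Suc s \<le> length (drop i fs)"
        using d i len less.prems(3) ends by (intro less.hyps) auto
      \<comment> \<open>If the walk had already reached its last facet at index \<open>i\<close>,
        stopping there would give a shorter walk.\<close>
      moreover have "hd (drop i fs) \<noteq> last (drop i fs)"
      proof
        assume "hd (drop i fs) = last (drop i fs)"
        then have "last (take (Suc i) fs) = last fs" using d last_take_Suc[of i fs] i len by simp
        moreover have "walk X d (take (Suc i) fs)" "hd (take (Suc i) fs) = hd fs"
          "length (take (Suc i) fs) < length fs"
          using walk_take[OF w] i len by auto
        ultimately show False using short by blast
      qed
      ultimately show ?thesis by auto
    next
      case False
      obtain v u where vu: "fs ! 0 - fs ! 1 = {v}" "fs ! m - fs ! (m - 1) = {u}"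
        using walk_ends_differ[OF w len m0] by blast
      then have vu': "v \<in> fs ! 0" "v \<notin> fs ! 1" "u \<in> fs ! m" "u \<notin> fs ! (m - 1)" by blast+
      have K: "c v = c u" "\<And>i. 0 < i \<Longrightarrow> i < m \<Longrightarrow> c v \<notin> c ` (fs ! i)"
        using walk_ends_iff[OF w len m0 vu'] False less.prems(3) ends by auto
      \<comment> \<open>A vertex equal to both would lie in the two end facets but in no interior
        one, which \<open>path_no_return\<close> rules out; for two facets the choice of
        \<open>v\<close> and \<open>u\<close> does so directly. This is why the walk was taken to be
        shortest.\<close>
      have "v \<noteq> u"
      proof
        assume eq: "v = u"
        have "m \<noteq> 1" using eq vu' by auto
        then have "3 \<le> length fs" using m0 len by simp
        then obtain i where "0 < i" "i < m" "v \<in> fs ! i"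
          using path_no_return[OF path, of v] eq vu' ends len by auto
        then show False using K(2) by blast
      qed
      then show ?thesis using scat[OF w, of v u] vu' ends K(1) by simp
    qed
  qed
qed

text \<open>Here walks suffice, as \<open>walk_ends_iff\<close> does not ask for a path. A vertex of
  the same colour in an interior facet differs from \<open>v\<close> or from \<open>u\<close>, and
  the corresponding part of the walk already satisfies the bound. In the remaining case the end
  facets have equal labels, and they differ by injectivity of \<open>c\<close> on facets.\<close>

lemma vertex_walk_length:
  assumes scat: "\<And>fs. walk X d fs \<Longrightarrow> hd fs \<noteq> last fs \<Longrightarrow> \<phi> (hd fs) = \<phi> (last fs) \<Longrightarrow> Suc s \<le> length fs"
    and "walk X d fs" "v \<in> hd fs" "u \<in> last fs" "v \<noteq> u" "c v = c u"
  shows "Suc s \<le> length fs"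
  using assms(2-)
proof (induction "length fs" arbitrary: fs v u rule: less_induct)
  case less
  note w = less.prems(1)
  have ne: "fs \<noteq> []" using w by (simp add: walk_def)
  define m where "m = length fs - 1"
  have len: "length fs = Suc m" using ne by (simp add: m_def)
  have ends: "hd fs = fs ! 0" "last fs = fs ! m"
    using ne by (auto simp: hd_conv_nth last_conv_nth m_def)
  have sep: "\<not> (v \<in> f \<and> u \<in> f)" if "f \<in> facets X" for f
    using less.prems(4,5) inj_on_facet[OF that] by (meson inj_onD)
  have mem: "fs ! 0 \<in> facets X" using w ne by (auto simp: walk_def subset_iff)
  have m0: "0 < m" using sep[OF mem] ends less.prems by (cases m) auto
  have left: "Suc s \<le> length fs" if "i < m" "x \<in> fs ! i" "c x = c v" "x \<noteq> v" for i x
  proof -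
    have "Suc s \<le> length (take (Suc i) fs)"
      using that len less.prems walk_take[OF w, of "Suc i"] last_take_Suc[of i fs]
      by (intro less.hyps[of "take (Suc i) fs" v x]) auto
    then show ?thesis by simp
  qed
  have right: "Suc s \<le> length fs" if "0 < i" "i \<le> m" "x \<in> fs ! i" "c x = c v" "x \<noteq> u" for i x
  proof -
    have "Suc s \<le> length (drop i fs)"
      using that len less.prems walk_drop[OF w, of i]
      by (intro less.hyps[of "drop i fs" x u]) (auto simp: hd_drop_conv_nth)
    then show ?thesis by simp
  qed
  consider i x where "0 < i" "i < m" "x \<in> fs ! i" "c x = c v"
    | "v \<in> fs ! 1"
    | "u \<in> fs ! (m - 1)"
    | "\<And>i. 0 < i \<Longrightarrow> i < m \<Longrightarrow> c v \<notin> c ` (fs ! i)" "v \<notin> fs ! 1" "u \<notin> fs ! (m - 1)"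
    by (metis imageE)
  then show ?case
  proof cases
    case (1 i x)
    then show ?thesis using left[of i x] right[of i x] less.prems(4) by (cases "x = v") auto
  next
    case 2
    then show ?thesis using right[of 1 v] m0 less.prems(4) by simp
  next
    case 3
    then show ?thesis using left[of "m - 1" u] m0 less.prems(4,5) by simp
  next
    case 4
    have "v \<in> fs ! 0" "u \<in> fs ! m" using less.prems ends by auto
    then have "\<phi> (fs ! 0) = \<phi> (fs ! m)"
      using walk_ends_iff[OF w len m0, of v u] 4 less.prems(5) by simp
    moreover have "fs ! 0 \<noteq> fs ! m" using sep[OF mem] less.prems(2,3) ends by auto
    ultimately show ?thesis using scat[OF w] ends by simp
  qed
qed

lemma vertex_scattered_fibres_iff:
  "(\<forall>P\<in>fibres c (vertices X). vertex_scattered X d s P) \<longleftrightarrow>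
    (\<forall>fs v u. walk X d fs \<longrightarrow> v \<in> hd fs \<longrightarrow> u \<in> last fs \<longrightarrow> v \<noteq> u \<longrightarrow> c v = c u \<longrightarrow> s \<le> length fs)"
proof (intro iffI allI impI ballI)
  fix fs v u
  assume scat: "\<forall>P\<in>fibres c (vertices X). vertex_scattered X d s P"
    and w: "walk X d fs" and vu: "v \<in> hd fs" "u \<in> last fs" "v \<noteq> u" "c v = c u"
  have "hd fs \<in> facets X" "last fs \<in> facets X" using w by (auto simp: walk_def)
  then have V: "v \<in> vertices X" "u \<in> vertices X"
    using vu unfolding vertices_eq_Union_facets by blast+
  then have "vertex_scattered X d s {y \<in> vertices X. c y = c v}"
    using scat by (auto simp: fibres_def)
  then show "s \<le> length fs" using w vu V unfolding vertex_scattered_iff by simp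
qed (auto simp: vertex_scattered_iff fibres_def)

lemma facet_scattered_fibres_iff:
  "(\<forall>Q\<in>fibres \<phi> (facets X). facet_scattered X d s Q) \<longleftrightarrow>
    (\<forall>fs. walk X d fs \<longrightarrow> hd fs \<noteq> last fs \<longrightarrow> \<phi> (hd fs) = \<phi> (last fs) \<longrightarrow> Suc s \<le> length fs)"
proof (intro iffI allI impI ballI)
  fix fs
  assume scat: "\<forall>Q\<in>fibres \<phi> (facets X). facet_scattered X d s Q"
    and w: "walk X d fs" and fs: "hd fs \<noteq> last fs" "\<phi> (hd fs) = \<phi> (last fs)"
  have F: "hd fs \<in> facets X" "last fs \<in> facets X" "fs \<noteq> []" using w by (auto simp: walk_def)
  then have "facet_scattered X d s {y \<in> facets X. \<phi> y = \<phi> (hd fs)}"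
    using scat by (auto simp: fibres_def)
  then have "s \<le> length fs - 1" using w fs F unfolding facet_scattered_iff by simp
  then show "Suc s \<le> length fs" using F(3) by (cases fs) auto
qed (fastforce simp: facet_scattered_iff fibres_def)

lemma scattered_fibres_iff:
  "(\<forall>P\<in>fibres c (vertices X). vertex_scattered X d (Suc s) P) \<longleftrightarrow>
    (\<forall>Q\<in>fibres \<phi> (facets X). facet_scattered X d s Q)"
  unfolding vertex_scattered_fibres_iff facet_scattered_fibres_iff
proof (intro iffI allI impI)
  fix fs
  assume scat: "\<forall>fs v u. walk X d fs \<longrightarrow> v \<in> hd fs \<longrightarrow> u \<in> last fs \<longrightarrow> v \<noteq> u \<longrightarrow> c v = c u \<longrightarrow> Suc s \<le> length fs"
    and fs: "walk X d fs" "hd fs \<noteq> last fs" "\<phi> (hd fs) = \<phi> (last fs)"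
  show "Suc s \<le> length fs" by (rule facet_walk_length[OF _ fs]) (simp add: scat)
next
  fix fs v u
  assume scat: "\<forall>fs. walk X d fs \<longrightarrow> hd fs \<noteq> last fs \<longrightarrow> \<phi> (hd fs) = \<phi> (last fs) \<longrightarrow> Suc s \<le> length fs"
    and fs: "walk X d fs" "v \<in> hd fs" "u \<in> last fs" "v \<noteq> u" "c v = c u"
  show "Suc s \<le> length fs" by (rule vertex_walk_length[OF _ fs]) (simp add: scat)
qed

end

section \<open>Existence of couplings\<close>

context stacked_complex
begin

text \<open>With \<open>P = c v\<close> the extension step leaves \<open>c\<close> unchanged, so
  only labels are created along the stacking order.\<close>

lemma exists_coupling_of_colouring:
  assumes inj: "\<And>f. f \<in> facets X \<Longrightarrow> inj_on c f" and cN: "c ` vertices X \<subseteq> N"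
    and N: "finite N" "card N = r + d" and r: "1 \<le> r"
  shows "\<exists>\<phi> \<alpha>. coupled d (facets X) c \<phi> \<alpha> N {..<r}"
proof -
  obtain f0 where "f0 \<in> facets X" using stacking_order by (metis list.set_sel(1))
  then show ?thesis
  proof (induction rule: stacking_induct)
    case (base f)
    have "c ` f \<subseteq> N" using base cN unfolding vertices_eq_Union_facets by blast
    \<comment> \<open>The label of the first facet is arbitrary; \<open>0\<close> is available
      because \<open>r\<close> is positive.\<close>
    then obtain \<alpha> where "coupled d {f} c (\<lambda>_. 0) \<alpha> N {..<r}"
      using coupled_singleton[of c f N "\<lambda>_. 0" "{..<r}" d] inj[OF base] N r card_facet[OF base] by auto
    then show ?case by blast
  next
    case (step S f h v)
    then obtain \<phi> \<alpha> where cp: "coupled d S c \<phi> \<alpha> N {..<r}" by blast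
    have "c v \<in> N" using cN step unfolding vertices_eq_Union_facets by blast
    moreover have "c v \<notin> c ` (f - {v})" using inj[of f] step by (auto simp: inj_on_def)
    ultimately have cv: "c v \<in> N - c ` (f - {v})" by blast
    have "card g = Suc d" if "g \<in> insert f S" for g using that step card_facet by auto
    from coupled_insert[OF cp this step(4,5,3,6) cv] show ?case
      unfolding fun_upd_triv by blast
  qed
qed

text \<open>Now the labels are prescribed. Surjectivity on the gluing face supplies a colour for the
  new vertex that leads to the required label, so \<open>\<phi>\<close> stays unchanged.\<close>

lemma exists_coupling_of_labelling:
  assumes \<phi>: "\<phi> ` facets X \<subseteq> R" and R: "finite R" "card R = r" and r: "1 \<le> r"
  shows "\<exists>c \<alpha>. coupled d (facets X) c \<phi> \<alpha> {..<r + d} R"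
proof -
  obtain f0 where "f0 \<in> facets X" using stacking_order by (metis list.set_sel(1))
  then show ?thesis
  proof (induction rule: stacking_induct)
    case (base f)
    have "card f \<le> card {..<r + d}" using card_facet[OF base] r by simp
    then obtain c where "c ` f \<subseteq> {..<r + d}" "inj_on c f"
      using card_le_inj[OF finite_facet[OF base]] by blast
    then obtain \<alpha> where "coupled d {f} c \<phi> \<alpha> {..<r + d} R"
      using coupled_singleton[of c f "{..<r + d}" \<phi> R d] R r \<phi> base card_facet[OF base]
      by (auto simp: image_subset_iff)
    then show ?case by blast
  next
    case (step S f h v)
    then obtain c \<alpha> where cp: "coupled d S c \<phi> \<alpha> {..<r + d} R" by blast
    have "card (h - (f - {v})) = card h - card (f - {v})"
      using step finite_facet[OF step(2)] by (intro card_Diff_subset) auto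
    then have "card (h - (f - {v})) = 1"
      using step card_facet finite_facet[OF step(2)] by (auto simp: subset_iff)
    then obtain u where u: "h - (f - {v}) = {u}" by (auto simp: card_1_singleton_iff)
    then have "f - {v} = h - {u}" "u \<in> h" using step(6) by auto
    then have "bij_betw (\<alpha> h) ({..<r + d} - c ` (f - {v})) R"
      using coupled_bij_betw[OF cp step(3), of u] by simp
    moreover have "\<phi> f \<in> R" using \<phi> step(2) by blast
    ultimately obtain P where P: "P \<in> {..<r + d} - c ` (f - {v})" "\<alpha> h P = \<phi> f"
      by (metis bij_betw_imp_surj_on imageE)
    have "card g = Suc d" if "g \<in> insert f S" for g using that step card_facet by auto
    from coupled_insert[OF cp this step(4,5,3,6) P(1)] show ?case
      unfolding P(2) fun_upd_triv by blast
  qed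
qed

end

section \<open>The two bijections\<close>

theorem theorem3p6:
  fixes X :: "'a set set" and d r s :: nat
  assumes "stacked X d" and "1 \<le> r" and "1 \<le> s"
  defines "A \<equiv> {VV. partition_on (vertices X) VV \<and> card VV = r + d \<and>
                     (\<forall>P\<in>VV. vertex_scattered X d (s + 1) P)}"
      and "B \<equiv> {FF. partition_on (facets X) FF \<and> card FF = r \<and>
                     (\<forall>Q\<in>FF. facet_scattered X d s Q)}"
  shows "bij_betw (Phi X d) A B \<and> bij_betw (Psi X d) B A \<and>
         (\<forall>VV\<in>A. Psi X d (Phi X d VV) = VV) \<and> (\<forall>FF\<in>B. Phi X d (Psi X d FF) = FF)"
proof -
  interpret stacked_complex X d by unfold_locales (rule assms(1))
  have AB: "Phi X d VV \<in> B \<and> Psi X d (Phi X d VV) = VV" if "VV \<in> A" for VV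
  proof -
    have VV: "partition_on (vertices X) VV" "card VV = r + d"
      "\<And>P. P \<in> VV \<Longrightarrow> vertex_scattered X d (s + 1) P"
      using that by (auto simp: A_def)
    obtain c where c: "\<And>x. x \<in> vertices X \<Longrightarrow> x \<in> c x" "c ` vertices X = VV" "fibres c (vertices X) = VV"
      by (rule partition_on_eq_fibres[OF VV(1)]) blast
    have "inj_on c f" if f: "f \<in> facets X" for f
    proof (rule inj_onI, rule ccontr)
      fix v u assume vu: "v \<in> f" "u \<in> f" "c v = c u" "v \<noteq> u"
      have "v \<in> vertices X" "u \<in> vertices X" using vu f unfolding vertices_eq_Union_facets by auto
      then have "v \<in> c v" "u \<in> c v" "c v \<in> VV" using c(1)[of v] c(1)[of u] c(2) vu(3) by auto
      \<comment> \<open>The walk consisting of \<open>f\<close> alone gives two of its vertices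
        distance 1, whereas \<open>s + 1\<close> is at least 2.\<close>
      then have "s + 1 \<le> length [f]"
        using VV(3)[of "c v"] walk_singleton[OF f, of d] vu unfolding vertex_scattered_iff
        by (metis last.simps list.sel(1))
      then show False using assms(3) by simp
    qed
    moreover have "finite VV" using VV(2) assms(2) by (intro card_ge_0_finite) simp
    \<comment> \<open>The parts of \<open>VV\<close> are the colours; as labels any \<open>r\<close>
      values would do.\<close>
    ultimately obtain \<phi> \<alpha> where cp: "coupled d (facets X) c \<phi> \<alpha> VV {..<r}"
      using exists_coupling_of_colouring[of c VV r] VV(2) assms(2) c(2) by blast
    interpret coupling X d c \<phi> \<alpha> VV "{..<r}" by unfold_locales (rule cp)
    have Phi: "Phi X d VV = fibres \<phi> (facets X)" using Phi_fibres c(3) by simp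
    have "card (fibres \<phi> (facets X)) = r" using label_surj[OF c(2)] by (simp add: card_fibres)
    moreover have "\<forall>Q\<in>fibres \<phi> (facets X). facet_scattered X d s Q"
      using scattered_fibres_iff[of s] VV(3) c(3) by simp
    ultimately show ?thesis
      using Phi Psi_fibres c(3) partition_on_fibres by (simp add: B_def)
  qed
  have BA: "Psi X d FF \<in> A \<and> Phi X d (Psi X d FF) = FF" if "FF \<in> B" for FF
  proof -
    have FF: "partition_on (facets X) FF" "card FF = r" "\<And>Q. Q \<in> FF \<Longrightarrow> facet_scattered X d s Q"
      using that by (auto simp: B_def)
    obtain \<phi> where \<phi>: "\<phi> ` facets X = FF" "fibres \<phi> (facets X) = FF"
      by (rule partition_on_eq_fibres[OF FF(1)])
    have "finite FF" using FF(2) assms(2) by (intro card_ge_0_finite) simp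
    \<comment> \<open>The roles are exchanged: the parts of \<open>FF\<close> are the labels, and
      the colours are the numbers below \<open>r + d\<close>.\<close>
    then obtain c \<alpha> where cp: "coupled d (facets X) c \<phi> \<alpha> {..<r + d} FF"
      using exists_coupling_of_labelling[of \<phi> FF r] FF(2) assms(2) \<phi>(1) by blast
    interpret coupling X d c \<phi> \<alpha> "{..<r + d}" FF by unfold_locales (rule cp)
    have Psi: "Psi X d FF = fibres c (vertices X)" using Psi_fibres \<phi>(2) by simp
    have "card (fibres c (vertices X)) = r + d" using colour_surj[OF \<phi>(1)] by (simp add: card_fibres)
    moreover have "\<forall>P\<in>fibres c (vertices X). vertex_scattered X d (s + 1) P"
      using scattered_fibres_iff[of s] FF(3) \<phi>(2) by simp
    ultimately show ?thesis
      using Psi Phi_fibres \<phi>(2) partition_on_fibres by (simp add: A_def)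
  qed
  have "bij_betw (Phi X d) A B"
    by (rule bij_betw_byWitness[where f' = "Psi X d"]) (use AB BA in auto)
  moreover have "bij_betw (Psi X d) B A"
    by (rule bij_betw_byWitness[where f' = "Phi X d"]) (use AB BA in auto)
  ultimately show ?thesis using AB BA by blast
qed

end
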